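(* Let $\frac{\pi}{3}<\theta<\frac{5\pi}{3}$ and $\alpha=\frac{\pi-\theta}{2}$, and let $x_\theta,y_\theta:[0,1]\to\mathbb{R}$ be the coordinate functions of the dragon curve $\mathcal{D}_\theta$. Let $X_\theta=\{(t,x_\theta(t)):t\in[0,1]\}$ and $Y_\theta=\{(t,y_\theta(t)):t\in[0,1]\}$ be their graphs. Then the box-counting dimensions of $X_\theta$ and $Y_\theta$ are $$\dim_B X_\theta=\dim_B Y_\theta=1-\frac{\log(\cos\alpha)}{\log 2}.$$
   Context: Coordinate functions of the dragon curve. Let $\theta\in(\pi/3,5\pi/3)$ and $\alpha=\frac{\pi-\theta}{2}$ (so $2\cos\alpha>1$). Define finite words $b_k=b_{k,1}b_{k,2}\cdots b_{k,2^k}$ of real numbers (integer multiples of $\alpha$) recursively by: $b_0$ is the one-letter word $0$; and for $k\ge 0$, $1\le i\le 2^k$, $(b_{k+1,2i-1},b_{k+1,2i})=(b_{k,i}+\alpha,\,b_{k,i}-\alpha)$ if $i$ is odd, and $(b_{k+1,2i-1},b_{k+1,2i})=(b_{k,i}-\alpha,\,b_{k,i}+\alpha)$ if $i$ is even. Put $f_{k,i}=\frac{\cos b_{k,i}}{(2\cos\alpha)^k}$ and $g_{k,i}=\frac{\sin b_{k,i}}{(2\cos\alpha)^k}$. For $k\ge0$ define $x_{\theta,k},y_{\theta,k}:[0,1]\to\mathbb{R}$ by $$x_{\theta,k}(t)=2^kf_{k,j}\left(t-\tfrac{j-1}{2^k}\right)+\sum_{i=1}^{j-1}f_{k,i},\qquad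 y_{\theta,k}(t)=2^kg_{k,j}\left(t-\tfrac{j-1}{2^k}\right)+\sum_{i=1}^{j-1}g_{k,i}$$ for $t\in\left[\frac{j-1}{2^k},\frac{j}{2^k}\right]$, $1\le j\le 2^k$. These are the coordinate functions of the $k$-th approximation $\mathcal{D}_{\theta,k}$ (a polygonal path of $2^k$ segments from $(0,0)$ to $(1,0)$, whose $j$-th segment has length $(2\cos\alpha)^{-k}$ and direction angle $b_{k,j}$). The coordinate functions of the dragon curve are the uniform limits $x_\theta=\lim_{k\to\infty}x_{\theta,k}$ and $y_\theta=\lim_{k\to\infty}y_{\theta,k}$. Box-counting dimension. For $\delta>0$, a $\delta$-mesh cube in $\mathbb{R}^2$ is a square $[m\delta,(m+1)\delta]\times[n\delta,(n+1)\delta]$ with $m,n\in\mathbb{Z}$. For a nonempty bounded set $\mathcal{Z}\subset\mathbb{R}^2$, $N_\delta(\mathcal{Z})$ is the number of $\delta$-mesh cubes that intersect $\mathcal{Z}$, and $\dim_B\mathcal{Z}=\lim_{\delta\to0}\frac{\log N_\delta(\mathcal{Z})}{-\log\delta}$ (the claim includes existence of the limit). *)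

theory Defs
  imports "HOL-Analysis.Analysis"
begin

section \<open>The angle words and the polygonal approximations\<close>

text \<open>
  The word \<open>b\<^sub>k\<close> is indexed from 1, so the letter at position \<open>i\<close> of \<open>b\<^sub>k\<^sub>+\<^sub>1\<close> is a
  child of the letter at position \<open>p = (i + 1) div 2\<close> of \<open>b\<^sub>k\<close>. Only the values at
  \<open>1 \<le> i \<le> 2 ^ k\<close> are meaningful.
\<close>

primrec dragon_angle :: "real \<Rightarrow> nat \<Rightarrow> nat \<Rightarrow> real" where
  "dragon_angle \<alpha> 0 i = 0"
| "dragon_angle \<alpha> (Suc k) i =
     (let p = (i + 1) div 2 in
      if odd p
      then (if odd i then dragon_angle \<alpha> k p + \<alpha> else dragon_angle \<alpha> k p - \<alpha>)
      else (if odd i then dragon_angle \<alpha> k p - \<alpha> else dragon_angle \<alpha> k p + \<alpha>))"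

lemma dragon_angle_children:
  assumes "1 \<le> i"
  shows "dragon_angle \<alpha> (Suc k) (2 * i - 1) =
           (if odd i then dragon_angle \<alpha> k i + \<alpha> else dragon_angle \<alpha> k i - \<alpha>)"
    and "dragon_angle \<alpha> (Suc k) (2 * i) =
           (if odd i then dragon_angle \<alpha> k i - \<alpha> else dragon_angle \<alpha> k i + \<alpha>)"
proof -
  have "(2 * i - 1 + 1) div 2 = i" "(2 * i + 1) div 2 = i" "odd (2 * i - 1)"
    using assms by auto
  then show "dragon_angle \<alpha> (Suc k) (2 * i - 1) =
           (if odd i then dragon_angle \<alpha> k i + \<alpha> else dragon_angle \<alpha> k i - \<alpha>)"
    and "dragon_angle \<alpha> (Suc k) (2 * i) =
           (if odd i then dragon_angle \<alpha> k i - \<alpha> else dragon_angle \<alpha> k i + \<alpha>)"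
    by (simp_all only: dragon_angle.simps Let_def) simp_all
qed

definition dragon_f :: "real \<Rightarrow> nat \<Rightarrow> nat \<Rightarrow> real" where
  "dragon_f \<alpha> k i = cos (dragon_angle \<alpha> k i) / (2 * cos \<alpha>) ^ k"

definition dragon_g :: "real \<Rightarrow> nat \<Rightarrow> nat \<Rightarrow> real" where
  "dragon_g \<alpha> k i = sin (dragon_angle \<alpha> k i) / (2 * cos \<alpha>) ^ k"

text \<open>
  The piecewise linear function on \<open>[0, 1]\<close> with increments \<open>h k i\<close> over the dyadic
  intervals of level \<open>k\<close>. The index \<open>j\<close> below selects one interval containing \<open>t\<close>; the
  lemma \<open>polygonal_eq\<close> shows that every other choice gives the same value.
\<close>

definition polygonal :: "(nat \<Rightarrow> nat \<Rightarrow> real) \<Rightarrow> nat \<Rightarrow> real \<Rightarrow> real" where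
  "polygonal h k t =
     (let j = max 1 (nat \<lceil>2 ^ k * t\<rceil>) in
      2 ^ k * h k j * (t - (real j - 1) / 2 ^ k) + (\<Sum>i = 1..j - 1. h k i))"

lemma polygonal_eq:
  assumes j: "1 \<le> j" and t: "t \<in> {(real j - 1) / 2 ^ k .. real j / 2 ^ k}"
  shows "polygonal h k t =
           2 ^ k * h k j * (t - (real j - 1) / 2 ^ k) + (\<Sum>i = 1..j - 1. h k i)"
proof (cases "t = (real j - 1) / 2 ^ k \<and> 2 \<le> j")
  case True
  then obtain m where m: "j = Suc (Suc m)"
    by (metis One_nat_def Suc_1 Suc_le_D Suc_le_mono)
  have tm: "t = real (Suc m) / 2 ^ k" using True m by simp
  then have "2 ^ k * t = real (Suc m)" by simp
  then have "max 1 (nat \<lceil>2 ^ k * t\<rceil>) = Suc m" by (simp only: ceiling_of_nat nat_int)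
  then have "polygonal h k t =
      2 ^ k * h k (Suc m) * (t - real m / 2 ^ k) + (\<Sum>i = 1..m. h k i)"
    by (simp add: polygonal_def)
  moreover have "2 ^ k * h k (Suc m) * (t - real m / 2 ^ k) = h k (Suc m)"
    unfolding tm by (simp add: field_simps)
  ultimately show ?thesis using True m by simp
next
  case False
  have "max 1 (nat \<lceil>2 ^ k * t\<rceil>) = j"
  proof (cases "t = (real j - 1) / 2 ^ k")
    case True
    with False j have "j = 1" by auto
    with True show ?thesis by simp
  next
    case neq: False
    then have "(real j - 1) / 2 ^ k < t" "t \<le> real j / 2 ^ k" using t by auto
    then have "real j - 1 < 2 ^ k * t" "2 ^ k * t \<le> real j"
      by (simp_all add: field_simps)
    then have "\<lceil>2 ^ k * t\<rceil> = int j" by linarith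
    with j show ?thesis by simp
  qed
  then show ?thesis by (simp add: polygonal_def)
qed

definition dragon_x_approx :: "real \<Rightarrow> nat \<Rightarrow> real \<Rightarrow> real" where
  "dragon_x_approx \<theta> = polygonal (dragon_f ((pi - \<theta>) / 2))"

definition dragon_y_approx :: "real \<Rightarrow> nat \<Rightarrow> real \<Rightarrow> real" where
  "dragon_y_approx \<theta> = polygonal (dragon_g ((pi - \<theta>) / 2))"


section \<open>The coordinate functions\<close>

text \<open>
  Defined as pointwise limits; \<open>uniform_limit_dragon_x\<close> and \<open>uniform_limit_dragon_y\<close>
  show that for \<open>pi / 3 < \<theta> < 5 * pi / 3\<close> they are the uniform limits on \<open>[0, 1]\<close>.
\<close>

definition dragon_x :: "real \<Rightarrow> real \<Rightarrow> real" where
  "dragon_x \<theta> t = lim (\<lambda>k. dragon_x_approx \<theta> k t)"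

definition dragon_y :: "real \<Rightarrow> real \<Rightarrow> real" where
  "dragon_y \<theta> t = lim (\<lambda>k. dragon_y_approx \<theta> k t)"

lemma dyadic_interval:
  fixes t :: real
  assumes "t \<in> {0..1}"
  obtains j where "1 \<le> j" "j \<le> 2 ^ k" "t \<in> {(real j - 1) / 2 ^ k .. real j / 2 ^ k}"
proof
  let ?j = "max 1 (nat \<lceil>2 ^ k * t\<rceil>)"
  have le: "0 \<le> 2 ^ k * t" "2 ^ k * t \<le> 2 ^ k" using assms by auto
  have "\<lceil>2 ^ k * t\<rceil> \<le> 2 ^ k" using le(2) by (simp add: ceiling_le_iff)
  then have "nat \<lceil>2 ^ k * t\<rceil> \<le> 2 ^ k" by (simp add: nat_le_iff)
  then show "1 \<le> ?j" "?j \<le> 2 ^ k" by auto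
  have "real ?j - 1 \<le> 2 ^ k * t" "2 ^ k * t \<le> real ?j" using le(1) by linarith+
  then show "t \<in> {(real ?j - 1) / 2 ^ k .. real ?j / 2 ^ k}" by (simp add: field_simps)
qed

lemma polygonal_uniform_limit:
  fixes h :: "nat \<Rightarrow> nat \<Rightarrow> real" and c :: real
  assumes c: "1 < c"
    and bound: "\<And>k i. \<bar>h k i\<bar> \<le> (1 / c) ^ k"
    and split: "\<And>k i. 1 \<le> i \<Longrightarrow> h (Suc k) (2 * i - 1) + h (Suc k) (2 * i) = h k i"
  shows "uniform_limit {0..1} (polygonal h) (\<lambda>t. lim (\<lambda>k. polygonal h k t)) sequentially"
proof -
  have sums: "(\<Sum>i = 1..2 * m. h (Suc k) i) = (\<Sum>i = 1..m. h k i)" for k m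
  proof (induction m)
    case (Suc m)
    then show ?case using split[of "Suc m" k] by simp
  qed simp
  have seg: "\<bar>2 ^ k * h k j * (t - (real j - 1) / 2 ^ k)\<bar> \<le> (1 / c) ^ k"
    if "t \<in> {(real j - 1) / 2 ^ k .. real j / 2 ^ k}" for k j t
  proof -
    have eq: "2 ^ k * h k j * (t - (real j - 1) / 2 ^ k) = h k j * (2 ^ k * t - (real j - 1))"
      by (simp add: field_simps)
    have "\<bar>2 ^ k * t - (real j - 1)\<bar> \<le> 1"
      using that by (auto simp: field_simps)
    then have "\<bar>h k j\<bar> * \<bar>2 ^ k * t - (real j - 1)\<bar> \<le> (1 / c) ^ k * 1"
      using c by (intro mult_mono bound) auto
    then show ?thesis unfolding eq abs_mult by simp
  qed
  have step: "\<bar>polygonal h (Suc k) t - polygonal h k t\<bar> \<le> 3 * (1 / c) ^ k"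
    if t: "t \<in> {0..1}" for k t
  proof -
    obtain j where j: "1 \<le> j" "j \<le> 2 ^ Suc k"
      and tj: "t \<in> {(real j - 1) / 2 ^ Suc k .. real j / 2 ^ Suc k}"
      using dyadic_interval[OF t] by blast
    define p where "p = (j + 1) div 2"
    have p: "1 \<le> p" "j = 2 * p - 1 \<or> j = 2 * p" using j(1) unfolding p_def by auto
    have "2 * real p - 2 \<le> real j - 1" "real j \<le> 2 * real p" using p by auto
    moreover have "real j - 1 \<le> 2 * (2 ^ k * t)" "2 * (2 ^ k * t) \<le> real j"
      using tj by (auto simp: field_simps)
    ultimately have "real p - 1 \<le> 2 ^ k * t" "2 ^ k * t \<le> real p" by linarith+
    then have tp: "t \<in> {(real p - 1) / 2 ^ k .. real p / 2 ^ k}" by (simp add: field_simps)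
    have pw: "(1 / c) ^ Suc k \<le> (1 / c) ^ k" using c by (simp add: field_simps)
    have "\<bar>(\<Sum>i = 1..j - 1. h (Suc k) i) - (\<Sum>i = 1..p - 1. h k i)\<bar> \<le> (1 / c) ^ Suc k"
    proof (cases "j = 2 * p")
      case True
      then have "j - 1 = Suc (2 * (p - 1))" using p by auto
      then have "(\<Sum>i = 1..j - 1. h (Suc k) i) = (\<Sum>i = 1..p - 1. h k i) + h (Suc k) (j - 1)"
        using sums[where m = "p - 1" and k = k] by simp
      then show ?thesis using bound[of "Suc k" "j - 1"] by simp
    next
      case False
      then have "j - 1 = 2 * (p - 1)" using p by auto
      then show ?thesis using sums[where m = "p - 1" and k = k] c by simp
    qed
    then show ?thesis
      using seg[OF tj] seg[OF tp] pw
      unfolding polygonal_eq[OF j(1) tj] polygonal_eq[OF p(1) tp] by linarith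
  qed
  have "uniformly_convergent_on {0..1}
          (\<lambda>n t. \<Sum>k<n. polygonal h (Suc k) t - polygonal h k t)"
  proof (rule Weierstrass_m_test')
    show "norm (polygonal h (Suc k) t - polygonal h k t) \<le> 3 * (1 / c) ^ k"
      if "t \<in> {0..1}" for k t using step[OF that] by simp
    show "summable (\<lambda>k. 3 * (1 / c) ^ k)"
      using c by (intro summable_mult summable_geometric) simp
  qed
  then obtain l where l: "uniform_limit {0..1}
      (\<lambda>n t. \<Sum>k<n. polygonal h (Suc k) t - polygonal h k t) l sequentially"
    by (auto simp: uniformly_convergent_on_def)
  have "uniform_limit {0..1}
      (\<lambda>n t. polygonal h 0 t + (\<Sum>k<n. polygonal h (Suc k) t - polygonal h k t))
      (\<lambda>t. polygonal h 0 t + l t) sequentially"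
    by (intro uniform_limit_add uniform_limit_const l)
  moreover have "polygonal h 0 t + (\<Sum>k<n. polygonal h (Suc k) t - polygonal h k t)
                   = polygonal h n t" for n t
    by (induction n) auto
  ultimately have U: "uniform_limit {0..1} (polygonal h) (\<lambda>t. polygonal h 0 t + l t) sequentially"
    by simp
  have "lim (\<lambda>k. polygonal h k t) = polygonal h 0 t + l t" if "t \<in> {0..1}" for t
    using tendsto_uniform_limitI[OF U that] by (rule limI)
  then show ?thesis using U unfolding uniform_limit_iff by simp
qed

lemma cos_half_gt:
  assumes "pi / 3 < \<theta>" "\<theta> < 5 * pi / 3"
  shows "1 < 2 * cos ((pi - \<theta>) / 2)"
proof -
  have "\<bar>(pi - \<theta>) / 2\<bar> < pi / 3" using assms by (auto simp: abs_if field_simps)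
  then have "cos (pi / 3) < cos \<bar>(pi - \<theta>) / 2\<bar>" by (intro cos_monotone_0_pi) auto
  then show ?thesis by (simp only: cos_60 cos_abs_real)
qed

lemma uniform_limit_dragon_x:
  assumes "pi / 3 < \<theta>" "\<theta> < 5 * pi / 3"
  shows "uniform_limit {0..1} (dragon_x_approx \<theta>) (dragon_x \<theta>) sequentially"
proof -
  define \<alpha> where "\<alpha> = (pi - \<theta>) / 2"
  have c: "1 < 2 * cos \<alpha>" using cos_half_gt[OF assms] by (simp add: \<alpha>_def)
  have "uniform_limit {0..1} (polygonal (dragon_f \<alpha>))
      (\<lambda>t. lim (\<lambda>k. polygonal (dragon_f \<alpha>) k t)) sequentially"
  proof (rule polygonal_uniform_limit[OF c])
    show "\<bar>dragon_f \<alpha> k i\<bar> \<le> (1 / (2 * cos \<alpha>)) ^ k" for k i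
      using c by (auto simp: dragon_f_def abs_mult power_abs power_divide intro!: divide_right_mono)
    show "dragon_f \<alpha> (Suc k) (2 * i - 1) + dragon_f \<alpha> (Suc k) (2 * i) = dragon_f \<alpha> k i"
      if "1 \<le> i" for k i
    proof -
      have "cos (dragon_angle \<alpha> (Suc k) (2 * i - 1)) + cos (dragon_angle \<alpha> (Suc k) (2 * i))
              = 2 * cos \<alpha> * cos (dragon_angle \<alpha> k i)"
        unfolding dragon_angle_children[OF that] by (simp add: cos_add cos_diff)
      then show ?thesis using c by (simp add: dragon_f_def add_divide_distrib[symmetric])
    qed
  qed
  then show ?thesis
    unfolding dragon_x_approx_def dragon_x_def[abs_def] \<alpha>_def[symmetric] .
qed

lemma uniform_limit_dragon_y:
  assumes "pi / 3 < \<theta>" "\<theta> < 5 * pi / 3"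
  shows "uniform_limit {0..1} (dragon_y_approx \<theta>) (dragon_y \<theta>) sequentially"
proof -
  define \<alpha> where "\<alpha> = (pi - \<theta>) / 2"
  have c: "1 < 2 * cos \<alpha>" using cos_half_gt[OF assms] by (simp add: \<alpha>_def)
  have "uniform_limit {0..1} (polygonal (dragon_g \<alpha>))
      (\<lambda>t. lim (\<lambda>k. polygonal (dragon_g \<alpha>) k t)) sequentially"
  proof (rule polygonal_uniform_limit[OF c])
    show "\<bar>dragon_g \<alpha> k i\<bar> \<le> (1 / (2 * cos \<alpha>)) ^ k" for k i
      using c by (auto simp: dragon_g_def abs_mult power_abs power_divide intro!: divide_right_mono)
    show "dragon_g \<alpha> (Suc k) (2 * i - 1) + dragon_g \<alpha> (Suc k) (2 * i) = dragon_g \<alpha> k i"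
      if "1 \<le> i" for k i
    proof -
      have "sin (dragon_angle \<alpha> (Suc k) (2 * i - 1)) + sin (dragon_angle \<alpha> (Suc k) (2 * i))
              = 2 * cos \<alpha> * sin (dragon_angle \<alpha> k i)"
        unfolding dragon_angle_children[OF that] by (simp add: sin_add sin_diff)
      then show ?thesis using c by (simp add: dragon_g_def add_divide_distrib[symmetric])
    qed
  qed
  then show ?thesis
    unfolding dragon_y_approx_def dragon_y_def[abs_def] \<alpha>_def[symmetric] .
qed


section \<open>Box-counting dimension\<close>

definition mesh_cubes :: "real \<Rightarrow> (real \<times> real) set set" where
  "mesh_cubes \<delta> =
     {{of_int m * \<delta> .. (of_int m + 1) * \<delta>} \<times> {of_int n * \<delta> .. (of_int n + 1) * \<delta>} | m n :: int. True}"

definition box_count :: "real \<Rightarrow> (real \<times> real) set \<Rightarrow> nat" where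
  "box_count \<delta> Z = card {Q \<in> mesh_cubes \<delta>. Q \<inter> Z \<noteq> {}}"

definition has_box_dimension :: "(real \<times> real) set \<Rightarrow> real \<Rightarrow> bool" where
  "has_box_dimension Z d \<longleftrightarrow> Z \<noteq> {} \<and> bounded Z \<and>
     ((\<lambda>\<delta>. ln (real (box_count \<delta> Z)) / (- ln \<delta>)) \<longlongrightarrow> d) (at_right 0)"

end

theory Submission
  imports Defs
begin

text \<open>
  Write \<open>r = 1 / (2 * cos \<alpha>)\<close>, so that \<open>1/2 \<le> r < 1\<close>, and let \<open>F\<close> be one of the two coordinate
  functions, with increments \<open>h k i\<close> over the dyadic intervals of level \<open>k\<close>. At scale
  \<open>\<delta> \<approx> 2 ^ -k\<close> the number of mesh squares that meet the graph is comparable to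
  \<open>(4 * r) ^ k\<close>, and \<open>4 * r = 2 / cos \<alpha>\<close> is 2 to the power of the claimed dimension.

  The upper bound comes from \<open>\<bar>h k i\<bar> \<le> r ^ k\<close>: since the \<open>k\<close>-th partial sums are already exact
  at dyadic points, summing a geometric series shows that \<open>F\<close> oscillates by \<open>O(r ^ k)\<close> over an
  interval of length \<open>2 ^ -k\<close> (\<open>limit_modulus\<close>). Each of the \<open>O(2 ^ k)\<close> columns thus contains
  \<open>O(2 ^ k * r ^ k)\<close> squares.

  For the lower bound, the intermediate value theorem forces the graph over the \<open>i\<close>-th dyadic
  interval to meet at least \<open>2 ^ k * \<bar>h k i\<bar>\<close> squares, and a square is shared by at most three
  intervals (\<open>sum_increments_le_card_met_cells\<close>). It remains to see that the segments of the
  polygonal path do not, on average, become perpendicular to the coordinate axis. Every angle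
  \<open>b\<close> has the two children \<open>b + \<alpha>\<close> and \<open>b - \<alpha>\<close>, so the sum of \<open>cos (2 * b)\<close> over level \<open>k\<close> is
  exactly \<open>(2 * cos (2 * \<alpha>)) ^ k\<close> (\<open>sum_cos_double_dragon_angle\<close>). Together with
  \<open>\<bar>cos b\<bar> \<ge> (cos b)\<^sup>2 = (1 + cos (2 * b)) / 2\<close>, the analogous formula for the sine, and
  \<open>-1/2 < cos (2 * \<alpha>)\<close>, this bounds the sum of \<open>\<bar>cos b\<bar>\<close> or \<open>\<bar>sin b\<bar>\<close> below by a constant times
  \<open>2 ^ k\<close> for \<open>k \<ge> 1\<close>. The only exception is the sine at \<open>\<alpha> = 0\<close>, where the
  graph is a horizontal segment.
\<close>

section \<open>Counting mesh squares that meet a graph\<close>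

definition met_cells :: "real \<Rightarrow> (real \<Rightarrow> real) \<Rightarrow> real set \<Rightarrow> (int \<times> int) set" where
  "met_cells \<delta> F T = {(m, n). \<exists>t\<in>T. of_int m * \<delta> \<le> t \<and> t \<le> (of_int m + 1) * \<delta> \<and>
                                   of_int n * \<delta> \<le> F t \<and> F t \<le> (of_int n + 1) * \<delta>}"

lemma met_cells_mono: "S \<subseteq> T \<Longrightarrow> met_cells \<delta> F S \<subseteq> met_cells \<delta> F T"
  by (auto simp: met_cells_def)

lemma box_count_graph:
  assumes \<delta>: "0 < \<delta>"
  shows "box_count \<delta> {(t, F t) | t. t \<in> T} = card (met_cells \<delta> F T)"
proof -
  define side where "side m = {of_int m * \<delta> .. (of_int m + 1) * \<delta>}" for m :: int
  define sq where "sq = (\<lambda>(m, n). side m \<times> side n)"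
  have ne: "side m \<noteq> {}" for m using \<delta> by (simp add: side_def)
  have side_inj: "m = n" if "side m = side n" for m n
    using that \<delta> ne[of m] ne[of n] by (simp add: side_def Icc_eq_Icc)
  have "inj_on sq (met_cells \<delta> F T)"
    unfolding sq_def inj_on_def using ne side_inj by (auto simp: times_eq_iff)
  moreover have "sq ` met_cells \<delta> F T = {Q \<in> mesh_cubes \<delta>. Q \<inter> {(t, F t) | t. t \<in> T} \<noteq> {}}"
    (is "?L = ?R")
  proof
    show "?L \<subseteq> ?R"
      by (fastforce simp: met_cells_def sq_def side_def mesh_cubes_def)
    show "?R \<subseteq> ?L"
    proof
      fix Q assume "Q \<in> ?R"
      then obtain m n where "Q = side m \<times> side n" "Q \<inter> {(t, F t) | t. t \<in> T} \<noteq> {}"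
        unfolding mesh_cubes_def side_def by blast
      then obtain t where "Q = side m \<times> side n" "t \<in> T" "t \<in> side m" "F t \<in> side n"
        by blast
      then have "Q = sq (m, n)" "(m, n) \<in> met_cells \<delta> F T"
        by (auto simp: sq_def met_cells_def side_def)
      then show "Q \<in> ?L" by blast
    qed
  qed
  ultimately show ?thesis
    unfolding box_count_def by (metis card_image)
qed

text \<open>
  A column contains at most \<open>2 * w / \<delta> + 2\<close> of the squares, because all values over it lie
  within \<open>w\<close> of one of them.
\<close>

lemma card_met_cells_le:
  assumes \<delta>: "0 < \<delta>"
    and osc: "\<And>s t. s \<in> {0..1} \<Longrightarrow> t \<in> {0..1} \<Longrightarrow> \<bar>s - t\<bar> \<le> \<delta> \<Longrightarrow> \<bar>F s - F t\<bar> \<le> w"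
  shows "finite (met_cells \<delta> F {0..1})"
    and "real (card (met_cells \<delta> F {0..1})) \<le> (1 / \<delta> + 2) * (2 * w / \<delta> + 2)"
proof -
  have w: "0 \<le> w" using osc[of 0 0] \<delta> by simp
  \<comment> \<open>Clamping the left edge of a column to the unit interval gives a reference point within \<open>\<delta>\<close>
    of every point of the column.\<close>
  define p where "p m = max 0 (min 1 (of_int m * \<delta>))" for m :: int
  define R where "R m = {\<lceil>(F (p m) - w) / \<delta>\<rceil> - 1 .. \<lfloor>(F (p m) + w) / \<delta>\<rfloor>}" for m
  define M where "M = {-1 .. \<lfloor>1 / \<delta>\<rfloor>}"
  have sub: "met_cells \<delta> F {0..1} \<subseteq> Sigma M R"
  proof clarify
    fix m n assume "(m, n) \<in> met_cells \<delta> F {0..1}"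
    then obtain t where t: "0 \<le> t" "t \<le> 1" "of_int m * \<delta> \<le> t" "t \<le> (of_int m + 1) * \<delta>"
      and F: "of_int n * \<delta> \<le> F t" "F t \<le> (of_int n + 1) * \<delta>"
      by (auto simp: met_cells_def)
    have "0 \<le> (of_int m + 1) * \<delta>" "of_int m * \<delta> \<le> 1" using t by linarith+
    then have "0 \<le> of_int m + (1 :: real)" "of_int m \<le> 1 / \<delta>"
      using \<delta> by (simp_all add: zero_le_mult_iff pos_le_divide_eq)
    then have m: "m \<in> M" by (auto simp: M_def le_floor_iff)
    have "\<bar>t - p m\<bar> \<le> \<delta>" using t \<delta> by (auto simp: p_def algebra_simps)
    then have "\<bar>F t - F (p m)\<bar> \<le> w" using t by (intro osc) (auto simp: p_def)
    then have "of_int n * \<delta> \<le> F (p m) + w" "F (p m) - w \<le> (of_int n + 1) * \<delta>"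
      using F by linarith+
    then have "of_int n \<le> (F (p m) + w) / \<delta>" "(F (p m) - w) / \<delta> \<le> of_int (n + 1)"
      using \<delta> by (simp_all add: field_simps)
    then have "n \<le> \<lfloor>(F (p m) + w) / \<delta>\<rfloor>" "\<lceil>(F (p m) - w) / \<delta>\<rceil> \<le> n + 1"
      unfolding le_floor_iff ceiling_le_iff by simp_all
    then show "m \<in> M \<and> n \<in> R m" using m by (simp add: R_def)
  qed
  have fin: "finite (Sigma M R)" by (auto simp: M_def R_def)
  show "finite (met_cells \<delta> F {0..1})" using finite_subset[OF sub fin] .
  have cardR: "real (card (R m)) \<le> 2 * w / \<delta> + 2" for m
  proof -
    have "(F (p m) + w) / \<delta> - (F (p m) - w) / \<delta> = 2 * w / \<delta>"
      by (simp flip: diff_divide_distrib)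
    moreover have "0 \<le> 2 * w / \<delta>" using w \<delta> by simp
    ultimately show ?thesis unfolding R_def card_atLeastAtMost_int by linarith
  qed
  have "0 < 1 / \<delta>" using \<delta> by simp
  then have cardM: "real (card M) \<le> 1 / \<delta> + 2" unfolding M_def card_atLeastAtMost_int by linarith
  have "real (card (met_cells \<delta> F {0..1})) \<le> real (card (Sigma M R))"
    using card_mono[OF fin sub] by simp
  also have "\<dots> = (\<Sum>m\<in>M. real (card (R m)))"
    by (subst card_SigmaI) (auto simp: M_def R_def)
  also have "\<dots> \<le> real (card M) * (2 * w / \<delta> + 2)"
    using sum_bounded_above[of M "\<lambda>m. real (card (R m))"] cardR by simp
  also have "\<dots> \<le> (1 / \<delta> + 2) * (2 * w / \<delta> + 2)"
    using cardM w \<delta> by (intro mult_right_mono) auto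
  finally show "real (card (met_cells \<delta> F {0..1})) \<le> (1 / \<delta> + 2) * (2 * w / \<delta> + 2)" .
qed

text \<open>
  By the intermediate value theorem the graph visits every row between those of the two
  endpoints.
\<close>

lemma card_met_cells_interval_ge:
  assumes \<delta>: "0 < \<delta>" and ab: "a \<le> b" and cont: "continuous_on {a..b} F"
    and fin: "finite (met_cells \<delta> F {a..b})"
  shows "max 1 (\<bar>F b - F a\<bar> / \<delta>) \<le> real (card (met_cells \<delta> F {a..b}))"
proof -
  define lo hi where "lo = min (F a) (F b)" and "hi = max (F a) (F b)"
  have rows: "{\<lfloor>lo / \<delta>\<rfloor> .. \<lfloor>hi / \<delta>\<rfloor>} \<subseteq> snd ` met_cells \<delta> F {a..b}"
  proof
    fix n assume "n \<in> {\<lfloor>lo / \<delta>\<rfloor> .. \<lfloor>hi / \<delta>\<rfloor>}"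
    then have "of_int n \<le> hi / \<delta>" "lo / \<delta> \<le> of_int n + 1"
      by (auto simp: le_floor_iff floor_le_iff)
    then have n: "of_int n * \<delta> \<le> hi" "lo \<le> (of_int n + 1) * \<delta>"
      using \<delta> by (simp_all add: field_simps)
    define v where "v = max lo (of_int n * \<delta>)"
    have v: "lo \<le> v" "v \<le> hi" "of_int n * \<delta> \<le> v" "v \<le> (of_int n + 1) * \<delta>"
      using n \<delta> by (auto simp: v_def lo_def hi_def algebra_simps)
    have "\<exists>t. a \<le> t \<and> t \<le> b \<and> F t = v"
    proof (cases "F a \<le> F b")
      case True
      then show ?thesis using v IVT'[OF _ _ ab cont, of v] by (simp add: lo_def hi_def)
    next
      case False
      then show ?thesis using v IVT2'[OF _ _ ab cont, of v] by (simp add: lo_def hi_def)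
    qed
    then obtain t where t: "t \<in> {a..b}" "F t = v" by auto
    have "of_int \<lfloor>t / \<delta>\<rfloor> * \<delta> \<le> t" "t \<le> (of_int \<lfloor>t / \<delta>\<rfloor> + 1) * \<delta>"
      using \<delta> floor_correct[of "t / \<delta>"]
      by (simp_all flip: pos_le_divide_eq pos_divide_le_eq add: less_imp_le)
    then have "(\<lfloor>t / \<delta>\<rfloor>, n) \<in> met_cells \<delta> F {a..b}"
      using t v unfolding met_cells_def by blast
    then show "n \<in> snd ` met_cells \<delta> F {a..b}" by force
  qed
  have "card {\<lfloor>lo / \<delta>\<rfloor> .. \<lfloor>hi / \<delta>\<rfloor>} \<le> card (met_cells \<delta> F {a..b})"
    using card_mono[OF _ rows] card_image_le[OF fin, of snd] fin by (meson finite_imageI le_trans)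
  then have "\<lfloor>hi / \<delta>\<rfloor> - \<lfloor>lo / \<delta>\<rfloor> + 1 \<le> int (card (met_cells \<delta> F {a..b}))"
    by (simp add: nat_le_iff)
  then have "real_of_int (\<lfloor>hi / \<delta>\<rfloor> - \<lfloor>lo / \<delta>\<rfloor> + 1) \<le> real (card (met_cells \<delta> F {a..b}))"
    by linarith
  moreover have "\<lfloor>lo / \<delta>\<rfloor> \<le> \<lfloor>hi / \<delta>\<rfloor>"
    using \<delta> by (intro floor_mono) (simp add: lo_def hi_def divide_right_mono)
  ultimately have "1 \<le> real (card (met_cells \<delta> F {a..b}))"
    "hi / \<delta> - lo / \<delta> \<le> real (card (met_cells \<delta> F {a..b}))"
    by linarith+
  moreover have "\<bar>F b - F a\<bar> / \<delta> = hi / \<delta> - lo / \<delta>"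
    unfolding diff_divide_distrib[symmetric] by (simp add: lo_def hi_def max_def min_def)
  ultimately show ?thesis by simp
qed

text \<open>
  Double counting of the pairs of a dyadic interval and a square met over it: an interval of
  length at most \<open>2 ^ -k\<close> meets at most three closed dyadic intervals of level \<open>k\<close>. The 1 in the
  maximum keeps the bound of order \<open>2 ^ k\<close> where the increments are too small for this, as for a
  constant function.
\<close>

lemma sum_increments_le_card_met_cells:
  assumes \<delta>: "0 < \<delta>" "\<delta> \<le> 1 / 2 ^ k" and cont: "continuous_on {0..1} F"
    and fin: "finite (met_cells \<delta> F {0..1})"
  shows "(\<Sum>i<2 ^ k. max 1 (2 ^ k * \<bar>F (real (Suc i) / 2 ^ k) - F (real i / 2 ^ k)\<bar>))
           \<le> 3 * real (card (met_cells \<delta> F {0..1}))"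
proof -
  let ?B = "met_cells \<delta> F {0..1}"
  define I where "I i = {real i / 2 ^ k .. real (Suc i) / 2 ^ k}" for i
  have I: "I i \<subseteq> {0..1}" if "i < 2 ^ k" for i
  proof -
    have "real (Suc i) \<le> real (2 ^ k)" using that by (intro of_nat_mono) simp
    then show ?thesis by (auto simp: I_def field_simps)
  qed
  have "max 1 (2 ^ k * \<bar>F (real (Suc i) / 2 ^ k) - F (real i / 2 ^ k)\<bar>)
          \<le> real (card (met_cells \<delta> F (I i)))" if i: "i < 2 ^ k" for i
  proof -
    have "max 1 (\<bar>F (real (Suc i) / 2 ^ k) - F (real i / 2 ^ k)\<bar> / \<delta>)
            \<le> real (card (met_cells \<delta> F (I i)))"
      unfolding I_def
    proof (rule card_met_cells_interval_ge[OF \<delta>(1)])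
      show "continuous_on {real i / 2 ^ k .. real (Suc i) / 2 ^ k} F"
        using continuous_on_subset[OF cont I[OF i]] by (simp add: I_def)
      show "finite (met_cells \<delta> F {real i / 2 ^ k .. real (Suc i) / 2 ^ k})"
        using finite_subset[OF met_cells_mono[OF I[OF i]] fin] by (simp add: I_def)
    qed (simp add: divide_right_mono)
    moreover have "2 ^ k * x \<le> x / \<delta>" if "0 \<le> x" for x :: real
    proof -
      have "2 ^ k \<le> 1 / \<delta>" using \<delta> by (simp add: field_simps)
      then show ?thesis using mult_right_mono[OF _ that] by fastforce
    qed
    ultimately show ?thesis by (smt (verit) abs_ge_zero)
  qed
  then have "(\<Sum>i<2 ^ k. max 1 (2 ^ k * \<bar>F (real (Suc i) / 2 ^ k) - F (real i / 2 ^ k)\<bar>))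
      \<le> (\<Sum>i<2 ^ k. real (card (met_cells \<delta> F (I i))))"
    by (intro sum_mono) simp
  also have "\<dots> = (\<Sum>i<2 ^ k. \<Sum>p\<in>?B. of_bool (p \<in> met_cells \<delta> F (I i)))"
  proof (intro sum.cong refl)
    fix i :: nat assume "i \<in> {..<2 ^ k}"
    then have "met_cells \<delta> F (I i) = ?B \<inter> {p. p \<in> met_cells \<delta> F (I i)}"
      using met_cells_mono[OF I] by auto
    then show "real (card (met_cells \<delta> F (I i))) = (\<Sum>p\<in>?B. of_bool (p \<in> met_cells \<delta> F (I i)))"
      using fin by (simp add: sum_of_bool_eq)
  qed
  also have "\<dots> = (\<Sum>p\<in>?B. \<Sum>i<2 ^ k. of_bool (p \<in> met_cells \<delta> F (I i)))"
    by (rule sum.swap)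
  also have "\<dots> \<le> (\<Sum>p\<in>?B. 3)"
  proof (intro sum_mono)
    fix p assume "p \<in> ?B"
    obtain m n where p: "p = (m, n)" by fastforce
    define a where "a = 2 ^ k * (of_int m * \<delta>)"
    let ?J = "{i \<in> {..<2 ^ k}. p \<in> met_cells \<delta> F (I i)}"
    have "int ` ?J \<subseteq> {\<lceil>a\<rceil> - 1 .. \<lfloor>a\<rfloor> + 1}"
    proof clarify
      fix i assume "p \<in> met_cells \<delta> F (I i)"
      then obtain t where "t \<in> I i" "of_int m * \<delta> \<le> t" "t \<le> (of_int m + 1) * \<delta>"
        by (auto simp: met_cells_def p)
      then have "of_int m * \<delta> \<le> real (Suc i) / 2 ^ k" "real i / 2 ^ k \<le> of_int m * \<delta> + 1 / 2 ^ k"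
        using \<delta>(2) by (auto simp: I_def algebra_simps)
      then have "a \<le> real i + 1" "real i \<le> a + 1"
        by (simp_all add: a_def field_simps)
      then show "int i \<in> {\<lceil>a\<rceil> - 1 .. \<lfloor>a\<rfloor> + 1}"
        unfolding atLeastAtMost_iff by linarith
    qed
    then have "card (int ` ?J) \<le> card {\<lceil>a\<rceil> - 1 .. \<lfloor>a\<rfloor> + 1}" by (intro card_mono) auto
    also have "\<dots> \<le> 3" unfolding card_atLeastAtMost_int by linarith
    finally have "card ?J \<le> 3" by (simp add: card_image)
    moreover have "(\<Sum>i<2 ^ k. of_bool (p \<in> met_cells \<delta> F (I i))) = real (card ?J)"
      by (simp add: sum_of_bool_eq Int_def)
    ultimately show "(\<Sum>i<2 ^ k. of_bool (p \<in> met_cells \<delta> F (I i))) \<le> (3 :: real)" by simp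
  qed
  finally show ?thesis by simp
qed

section \<open>From dyadic growth to the box dimension\<close>

text \<open>
  At such a scale \<open>q ^ k\<close> and \<open>\<delta> powr (- ln q / ln 2)\<close> agree up to a factor \<open>q\<close>. After taking
  logarithms, this factor and the constants disappear in the division by \<open>- ln \<delta>\<close>.
\<close>

lemma ln_ratio_tendsto_of_dyadic_growth:
  fixes N :: "real \<Rightarrow> real"
  assumes q: "1 \<le> q" and c: "0 < c"
    and lower: "\<And>k \<delta>. 1 / 2 ^ Suc k < \<delta> \<Longrightarrow> \<delta> \<le> 1 / 2 ^ k \<Longrightarrow> c * q ^ k \<le> N \<delta>"
    and upper: "\<And>k \<delta>. 1 / 2 ^ Suc k < \<delta> \<Longrightarrow> \<delta> \<le> 1 / 2 ^ k \<Longrightarrow> N \<delta> \<le> C * q ^ k"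
  shows "((\<lambda>\<delta>. ln (N \<delta>) / (- ln \<delta>)) \<longlongrightarrow> ln q / ln 2) (at_right 0)"
proof -
  define d where "d = ln q / ln 2"
  have d: "0 \<le> d" "ln q = d * ln 2" using q by (auto simp: d_def)
  have main: "(ln c - d * ln 2) / (- ln \<delta>) + d \<le> ln (N \<delta>) / (- ln \<delta>)
      \<and> ln (N \<delta>) / (- ln \<delta>) \<le> ln C / (- ln \<delta>) + d"
    if \<delta>: "0 < \<delta>" "\<delta> < 1" for \<delta>
  proof -
    define L where "L = - ln \<delta>"
    define k where "k = nat \<lfloor>L / ln 2\<rfloor>"
    have L: "0 < L" using \<delta> by (simp add: L_def)
    then have "0 \<le> L / ln 2" by simp
    then have "real k \<le> L / ln 2" "L / ln 2 < real (Suc k)"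
      unfolding k_def by linarith+
    then have k: "real k * ln 2 \<le> L" "L < real (Suc k) * ln 2"
      by (simp_all add: field_simps)
    have lnp: "ln (1 / 2 ^ j) = - (real j * ln 2)" for j :: nat
      by (simp add: ln_div ln_realpow)
    have pos: "0 < 1 / (2 :: real) ^ j" for j by simp
    have "ln \<delta> \<le> ln (1 / 2 ^ k)" "ln (1 / 2 ^ Suc k) < ln \<delta>"
      using k unfolding lnp L_def by linarith+
    then have "\<delta> \<le> 1 / 2 ^ k" "1 / 2 ^ Suc k < \<delta>"
      using ln_le_cancel_iff[OF \<delta>(1) pos] ln_less_cancel_iff[OF pos \<delta>(1)] by blast+
    then have N: "c * q ^ k \<le> N \<delta>" "N \<delta> \<le> C * q ^ k"
      using lower upper by auto
    have qk: "0 < q ^ k" using q by simp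
    have Npos: "0 < N \<delta>" using N(1) mult_pos_pos[OF c qk] by linarith
    then have C: "0 < C" using N(2) qk by (smt (verit) zero_less_mult_pos2)
    have "ln (c * q ^ k) \<le> ln (N \<delta>)" "ln (N \<delta>) \<le> ln (C * q ^ k)"
      using N Npos c qk C by (auto simp: ln_le_cancel_iff)
    then have ln: "ln c + d * (real k * ln 2) \<le> ln (N \<delta>)" "ln (N \<delta>) \<le> ln C + d * (real k * ln 2)"
      using c C qk q by (simp_all add: ln_mult ln_realpow d(2) mult_ac)
    have "d * (real k * ln 2) \<le> d * L" "d * (L - ln 2) \<le> d * (real k * ln 2)"
      using k d(1) by (auto intro!: mult_left_mono simp: distrib_right)
    then have "ln c - d * ln 2 + d * L \<le> ln (N \<delta>)" "ln (N \<delta>) \<le> ln C + d * L"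
      using ln by (auto simp: algebra_simps)
    moreover have "a / L + d = (a + d * L) / L" for a
      using L by (simp add: add_divide_distrib)
    ultimately show ?thesis
      using L unfolding L_def[symmetric] by (simp add: divide_right_mono)
  qed
  have vanish: "((\<lambda>\<delta>. a / (- ln \<delta>) + d) \<longlongrightarrow> d) (at_right 0)" for a :: real
  proof -
    have "((\<lambda>\<delta>. a / (- ln \<delta>)) \<longlongrightarrow> 0) (at_right (0 :: real))"
      by (intro tendsto_divide_0[OF tendsto_const] filterlim_at_top_imp_at_infinity
          filterlim_compose[OF filterlim_uminus_at_top_at_bot ln_at_0])
    from tendsto_add[OF this tendsto_const[of d]] show ?thesis by simp
  qed
  have small: "\<forall>\<^sub>F \<delta> in at_right (0 :: real). 0 < \<delta> \<and> \<delta> < 1"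
    using eventually_at_right_real[of 0 1] by simp
  have "((\<lambda>\<delta>. ln (N \<delta>) / (- ln \<delta>)) \<longlongrightarrow> d) (at_right 0)"
    by (rule tendsto_sandwich[OF _ _ vanish[of "ln c - d * ln 2"] vanish[of "ln C"]])
      (use main in \<open>auto intro: eventually_mono[OF small]\<close>)
  then show ?thesis by (simp add: d_def)
qed

section \<open>Limits of dyadic interpolations\<close>

lemma power_4_mult: "(4 * x) ^ k = 2 ^ k * (2 * x) ^ k" for x :: real
proof -
  have "(4 * x) ^ k = (2 * (2 * x)) ^ k" by simp
  then show ?thesis by (simp only: power_mult_distrib)
qed

locale dyadic_increments =
  fixes h :: "nat \<Rightarrow> nat \<Rightarrow> real" and r :: real
  assumes r_ge: "1 / 2 \<le> r" and r_less: "r < 1"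
    and bound: "\<And>k i. \<bar>h k i\<bar> \<le> r ^ k"
    and refine: "\<And>k i. 1 \<le> i \<Longrightarrow> h (Suc k) (2 * i - 1) + h (Suc k) (2 * i) = h k i"
begin

definition partial :: "nat \<Rightarrow> nat \<Rightarrow> real" where
  "partial k j = (\<Sum>i = 1..j. h k i)"

definition limit :: "real \<Rightarrow> real" where
  "limit t = lim (\<lambda>k. polygonal h k t)"

lemma r_pos: "0 < r" using r_ge by simp

lemma tendsto_limit:
  assumes "t \<in> {0..1}"
  shows "(\<lambda>k. polygonal h k t) \<longlonglongrightarrow> limit t"
proof -
  have "uniform_limit {0..1} (polygonal h) (\<lambda>t. lim (\<lambda>k. polygonal h k t)) sequentially"
    using r_pos r_less bound refine by (intro polygonal_uniform_limit[of "1 / r"]) auto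
  then show ?thesis using assms unfolding limit_def by (rule tendsto_uniform_limitI)
qed

lemma partial_double: "partial (Suc k) (2 * m) = partial k m"
proof (induction m)
  case (Suc m)
  then show ?case using refine[of "Suc m" k] by (simp add: partial_def)
qed (simp add: partial_def)

lemma partial_refine: "partial (k + n) (2 ^ n * m) = partial k m"
proof (induction n)
  case (Suc n)
  then show ?case using partial_double[of "k + n" "2 ^ n * m"] by (simp add: mult.assoc)
qed simp

text \<open>
  Passing from one level to the previous one changes a partial sum by at most one increment;
  the right-hand side is the resulting geometric sum, cleared of its denominator.
\<close>

lemma partial_ancestor:
  "(1 - r) * \<bar>partial (k + n) j - partial k (j div 2 ^ n)\<bar> \<le> r ^ Suc k - r ^ Suc (k + n)"
proof (induction n arbitrary: j)
  case (Suc n)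
  have "\<bar>partial (Suc (k + n)) j - partial (k + n) (j div 2)\<bar> \<le> r ^ Suc (k + n)"
  proof (cases "even j")
    case True
    then obtain m where "j = 2 * m" by (rule evenE)
    then show ?thesis
      using partial_double[of "k + n" m] r_pos by simp
  next
    case False
    then obtain m where "j = 2 * m + 1" by (rule oddE)
    then have "partial (Suc (k + n)) j = partial (k + n) (j div 2) + h (Suc (k + n)) j"
      using partial_double[of "k + n" m] by (simp add: partial_def)
    then show ?thesis using bound[of "Suc (k + n)" j] by simp
  qed
  then have "(1 - r) * \<bar>partial (Suc (k + n)) j - partial (k + n) (j div 2)\<bar>
      \<le> (1 - r) * r ^ Suc (k + n)"
    using r_less by (intro mult_left_mono) auto
  moreover have "(1 - r) * \<bar>partial (k + n) (j div 2) - partial k (j div 2 ^ Suc n)\<bar>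
      \<le> r ^ Suc k - r ^ Suc (k + n)"
    using Suc.IH[of "j div 2"] by (simp add: div_mult2_eq)
  moreover have "(1 - r) * \<bar>partial (Suc (k + n)) j - partial k (j div 2 ^ Suc n)\<bar>
      \<le> (1 - r) * (\<bar>partial (Suc (k + n)) j - partial (k + n) (j div 2)\<bar>
        + \<bar>partial (k + n) (j div 2) - partial k (j div 2 ^ Suc n)\<bar>)"
    using r_less by (intro mult_left_mono) auto
  ultimately show ?case by (simp add: algebra_simps)
qed simp

lemma polygonal_near_partial:
  assumes t: "t \<in> {0..1}"
  shows "\<bar>polygonal h (k + n) t - partial k (nat \<lfloor>2 ^ k * t\<rfloor>)\<bar> \<le> r ^ k / (1 - r)"
proof -
  define j where "j = nat \<lfloor>2 ^ (k + n) * t\<rfloor>"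
  have "0 \<le> 2 ^ (k + n) * t" using t by simp
  then have j: "real j \<le> 2 ^ (k + n) * t" "2 ^ (k + n) * t < real j + 1"
    unfolding j_def by linarith+
  have "\<lfloor>2 ^ k * t\<rfloor> = \<lfloor>2 ^ (k + n) * t / of_int (2 ^ n)\<rfloor>"
    by (simp add: power_add)
  also have "\<dots> = \<lfloor>2 ^ (k + n) * t\<rfloor> div 2 ^ n"
    by (rule floor_divide_real_eq_div) simp
  finally have anc: "nat \<lfloor>2 ^ k * t\<rfloor> = j div 2 ^ n"
    using t by (simp add: j_def nat_div_distrib nat_power_eq)
  have "t \<in> {(real (Suc j) - 1) / 2 ^ (k + n) .. real (Suc j) / 2 ^ (k + n)}"
    using j by (simp add: field_simps)
  from polygonal_eq[OF _ this, of h]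
  have "polygonal h (k + n) t - partial (k + n) j
      = h (k + n) (Suc j) * (2 ^ (k + n) * t - real j)"
    by (simp add: partial_def right_diff_distrib)
  moreover have "\<bar>h (k + n) (Suc j) * (2 ^ (k + n) * t - real j)\<bar> \<le> r ^ (k + n) * 1"
    unfolding abs_mult using j r_pos by (intro mult_mono bound) auto
  moreover have "r ^ (k + n) \<le> r ^ k" using r_pos r_less by (intro power_decreasing) auto
  ultimately have "\<bar>polygonal h (k + n) t - partial (k + n) j\<bar> \<le> r ^ k" by simp
  then have "(1 - r) * \<bar>polygonal h (k + n) t - partial (k + n) j\<bar> \<le> (1 - r) * r ^ k"
    using r_less by (intro mult_left_mono) auto
  moreover have "(1 - r) * \<bar>partial (k + n) j - partial k (j div 2 ^ n)\<bar> \<le> r ^ Suc k"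
    using partial_ancestor[of k n j] r_pos zero_le_power[of r "Suc (k + n)"] by linarith
  moreover have "(1 - r) * \<bar>polygonal h (k + n) t - partial k (j div 2 ^ n)\<bar>
      \<le> (1 - r) * (\<bar>polygonal h (k + n) t - partial (k + n) j\<bar>
        + \<bar>partial (k + n) j - partial k (j div 2 ^ n)\<bar>)"
    using r_less by (intro mult_left_mono) auto
  ultimately have "(1 - r) * \<bar>polygonal h (k + n) t - partial k (j div 2 ^ n)\<bar> \<le> r ^ k"
    by (simp add: algebra_simps)
  then show ?thesis unfolding anc using r_less by (simp add: field_simps)
qed

lemma limit_near_partial:
  assumes t: "t \<in> {0..1}"
  shows "\<bar>limit t - partial k (nat \<lfloor>2 ^ k * t\<rfloor>)\<bar> \<le> r ^ k / (1 - r)"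
proof (rule LIMSEQ_le_const2)
  show "(\<lambda>n. \<bar>polygonal h (n + k) t - partial k (nat \<lfloor>2 ^ k * t\<rfloor>)\<bar>)
          \<longlonglongrightarrow> \<bar>limit t - partial k (nat \<lfloor>2 ^ k * t\<rfloor>)\<bar>"
    by (intro tendsto_intros LIMSEQ_ignore_initial_segment tendsto_limit t)
  show "\<exists>N. \<forall>n\<ge>N. \<bar>polygonal h (n + k) t - partial k (nat \<lfloor>2 ^ k * t\<rfloor>)\<bar> \<le> r ^ k / (1 - r)"
    using polygonal_near_partial[OF t, of k] by (simp add: add.commute)
qed

text \<open>The sequence of approximations is constant from level \<open>k\<close> on at a dyadic point of level \<open>k\<close>.\<close>

lemma limit_dyadic:
  assumes "j \<le> 2 ^ k"
  shows "limit (real j / 2 ^ k) = partial k j"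
proof -
  have t: "real j / 2 ^ k \<in> {0..1}"
    using of_nat_mono[OF assms, where 'a = real] by (simp add: field_simps)
  have "polygonal h (n + k) (real j / 2 ^ k) = partial k j" for n
  proof -
    have eq: "real j / 2 ^ k = (real (Suc (2 ^ n * j)) - 1) / 2 ^ (n + k)"
      by (simp add: power_add field_simps)
    have "real j / 2 ^ k \<in> {(real (Suc (2 ^ n * j)) - 1) / 2 ^ (n + k) ..
                             real (Suc (2 ^ n * j)) / 2 ^ (n + k)}"
      unfolding eq by (simp add: divide_right_mono)
    from polygonal_eq[OF _ this, of h]
    have "polygonal h (n + k) (real j / 2 ^ k) = partial (n + k) (2 ^ n * j)"
      using eq by (simp add: partial_def)
    then show ?thesis using partial_refine[of k n j] by (simp add: add.commute)
  qed
  then have "(\<lambda>n. polygonal h (n + k) (real j / 2 ^ k)) \<longlonglongrightarrow> partial k j" by simp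
  moreover have "(\<lambda>n. polygonal h (n + k) (real j / 2 ^ k)) \<longlonglongrightarrow> limit (real j / 2 ^ k)"
    by (intro LIMSEQ_ignore_initial_segment tendsto_limit t)
  ultimately show ?thesis using LIMSEQ_unique by blast
qed

definition modulus_const :: real where
  "modulus_const = 2 / (1 - r) + 1"

lemma modulus_const_pos: "0 < modulus_const"
  using r_less by (simp add: modulus_const_def add_pos_pos)

text \<open>
  This is Hoelder continuity with exponent \<open>- ln r / ln 2\<close>, in dyadic form. Two points at
  distance at most \<open>2 ^ -k\<close> lie in the same or in adjacent dyadic intervals of level \<open>k\<close>.
\<close>

lemma limit_modulus:
  assumes "s \<in> {0..1}" "t \<in> {0..1}" "\<bar>s - t\<bar> \<le> 1 / 2 ^ k"
  shows "\<bar>limit s - limit t\<bar> \<le> modulus_const * r ^ k"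
  using assms
proof (induction s t rule: linorder_wlog)
  case (le s t)
  define p q where "p = nat \<lfloor>2 ^ k * s\<rfloor>" and "q = nat \<lfloor>2 ^ k * t\<rfloor>"
  have "2 ^ k * s \<le> 2 ^ k * t" "0 \<le> 2 ^ k * s" "2 ^ k * t \<le> 2 ^ k * s + 1"
    using le by (auto simp: field_simps)
  then have "q = p \<or> q = Suc p" unfolding p_def q_def by linarith
  then have "\<bar>partial k p - partial k q\<bar> \<le> r ^ k"
    using bound[of k "Suc p"] r_pos by (auto simp: partial_def)
  moreover have "\<bar>limit s - partial k p\<bar> \<le> r ^ k / (1 - r)" "\<bar>limit t - partial k q\<bar> \<le> r ^ k / (1 - r)"
    using limit_near_partial le unfolding p_def q_def by auto
  moreover have "modulus_const * r ^ k = r ^ k / (1 - r) + r ^ k / (1 - r) + r ^ k"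
    by (simp add: modulus_const_def algebra_simps)
  ultimately show ?case by linarith
next
  case (sym s t)
  then show ?case by (simp add: abs_minus_commute)
qed

lemma continuous_on_limit: "continuous_on {0..1} limit"
  unfolding continuous_on_iff
proof (intro ballI allI impI)
  fix t e :: real assume t: "t \<in> {0..1}" and e: "0 < e"
  obtain k where "r ^ k < e / modulus_const"
    using real_arch_pow_inv[OF _ r_less] e modulus_const_pos by (meson divide_pos_pos)
  then have k: "modulus_const * r ^ k < e"
    using modulus_const_pos by (simp add: field_simps)
  show "\<exists>d>0. \<forall>s\<in>{0..1}. dist s t < d \<longrightarrow> dist (limit s) (limit t) < e"
  proof (intro exI[of _ "1 / 2 ^ k"] conjI ballI impI)
    fix s :: real assume "s \<in> {0..1}" "dist s t < 1 / 2 ^ k"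
    then show "dist (limit s) (limit t) < e"
      using limit_modulus[of s t k] t k by (simp add: dist_real_def)
  qed simp
qed

lemma bounded_graph_limit: "bounded {(t, limit t) | t. t \<in> {0..1}}"
proof -
  have "compact ((\<lambda>t. (t, limit t)) ` {0..1})"
    by (intro compact_continuous_image continuous_intros continuous_on_limit) auto
  moreover have "{(t, limit t) | t. t \<in> {0..1}} = (\<lambda>t. (t, limit t)) ` {0..1}" by auto
  ultimately show ?thesis by (simp add: compact_imp_bounded)
qed

lemma has_box_dimension_limit:
  assumes c: "0 < c"
    and large: "\<And>k. c * (4 * r) ^ k \<le> (\<Sum>i = 1..2 ^ k. max 1 (2 ^ k * \<bar>h k i\<bar>))"
  shows "has_box_dimension {(t, limit t) | t. t \<in> {0..1}} (ln (4 * r) / ln 2)"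
proof -
  let ?G = "{(t, limit t) | t. t \<in> {0..1}}"
  let ?K = modulus_const
  have osc: "\<bar>limit s - limit t\<bar> \<le> ?K * r ^ k"
    if "\<delta> \<le> 1 / 2 ^ k" "s \<in> {0..1}" "t \<in> {0..1}" "\<bar>s - t\<bar> \<le> \<delta>" for \<delta> s t k
    using limit_modulus that by auto
  have "((\<lambda>\<delta>. ln (real (box_count \<delta> ?G)) / (- ln \<delta>)) \<longlongrightarrow> ln (4 * r) / ln 2) (at_right 0)"
  proof (rule ln_ratio_tendsto_of_dyadic_growth)
    fix k :: nat and \<delta> :: real
    assume \<delta>: "1 / 2 ^ Suc k < \<delta>" "\<delta> \<le> 1 / 2 ^ k"
    have pos: "0 < \<delta>" using \<delta>(1) by (smt (verit) zero_less_divide_1_iff zero_less_power)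
    note upper = card_met_cells_le[OF pos osc[OF \<delta>(2)]]
    have "(\<Sum>i = 1..2 ^ k. max 1 (2 ^ k * \<bar>h k i\<bar>))
        = (\<Sum>i<2 ^ k. max 1 (2 ^ k * \<bar>limit (real (Suc i) / 2 ^ k) - limit (real i / 2 ^ k)\<bar>))"
      unfolding One_nat_def sum.atLeast1_atMost_eq
    proof (intro sum.cong refl)
      fix i :: nat assume "i \<in> {..<2 ^ k}"
      then have "limit (real (Suc i) / 2 ^ k) - limit (real i / 2 ^ k) = h k (Suc i)"
        by (subst (1 2) limit_dyadic) (auto simp: partial_def)
      then show "max 1 (2 ^ k * \<bar>h k (Suc i)\<bar>)
        = max 1 (2 ^ k * \<bar>limit (real (Suc i) / 2 ^ k) - limit (real i / 2 ^ k)\<bar>)" by simp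
    qed
    then show "c / 3 * (4 * r) ^ k \<le> real (box_count \<delta> ?G)"
      using large[of k] sum_increments_le_card_met_cells[OF pos \<delta>(2) continuous_on_limit upper(1)]
      unfolding box_count_graph[OF pos] by simp
    have inv: "1 / \<delta> \<le> 2 * 2 ^ k" using \<delta>(1) pos by (simp add: field_simps)
    have "1 \<le> (2 :: real) ^ k" by simp
    with inv have A: "1 / \<delta> + 2 \<le> 4 * 2 ^ k" by linarith
    have w: "0 \<le> ?K * r ^ k" using modulus_const_pos r_pos by simp
    have "2 * (?K * r ^ k) / \<delta> = 2 * (?K * r ^ k) * (1 / \<delta>)" by simp
    also have "\<dots> \<le> 2 * (?K * r ^ k) * (2 * 2 ^ k)"
      using inv w by (intro mult_left_mono) auto
    also have "\<dots> = 4 * ?K * (2 * r) ^ k" by (simp add: power_mult_distrib)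
    finally have "2 * (?K * r ^ k) / \<delta> \<le> 4 * ?K * (2 * r) ^ k" .
    moreover have "1 \<le> (2 * r) ^ k" using r_ge by (intro one_le_power) simp
    ultimately have B: "2 * (?K * r ^ k) / \<delta> + 2 \<le> (4 * ?K + 2) * (2 * r) ^ k"
      by (simp add: algebra_simps)
    have "real (box_count \<delta> ?G) \<le> (1 / \<delta> + 2) * (2 * (?K * r ^ k) / \<delta> + 2)"
      unfolding box_count_graph[OF pos] by (rule upper(2))
    also have "\<dots> \<le> (4 * 2 ^ k) * ((4 * ?K + 2) * (2 * r) ^ k)"
      using A B pos w by (intro mult_mono) auto
    also have "\<dots> = 4 * (4 * ?K + 2) * (4 * r) ^ k"
      unfolding power_4_mult by (simp only: mult_ac)
    finally show "real (box_count \<delta> ?G) \<le> 4 * (4 * ?K + 2) * (4 * r) ^ k" .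
  qed (use r_ge c in auto)
  then show ?thesis
    using bounded_graph_limit unfolding has_box_dimension_def by fastforce
qed

text \<open>
  The increments need to be of their maximal order \<open>r ^ k\<close> only on average. Level 0 is left out
  because the initial segment of the dragon curve is horizontal, so that its vertical increment
  vanishes.
\<close>

lemma has_box_dimension_limit_of_average:
  assumes c: "0 < c" "c \<le> 1"
    and large: "\<And>k. 0 < k \<Longrightarrow> c * (2 * r) ^ k \<le> (\<Sum>i = 1..2 ^ k. \<bar>h k i\<bar>)"
  shows "has_box_dimension {(t, limit t) | t. t \<in> {0..1}} (ln (4 * r) / ln 2)"
proof (rule has_box_dimension_limit[OF c(1)])
  fix k :: nat
  show "c * (4 * r) ^ k \<le> (\<Sum>i = 1..2 ^ k. max 1 (2 ^ k * \<bar>h k i\<bar>))"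
  proof (cases "k = 0")
    case False
    have "c * (4 * r) ^ k = 2 ^ k * (c * (2 * r) ^ k)" unfolding power_4_mult by (simp only: mult_ac)
    also have "\<dots> \<le> 2 ^ k * (\<Sum>i = 1..2 ^ k. \<bar>h k i\<bar>)"
      using large False by (intro mult_left_mono) auto
    also have "\<dots> \<le> (\<Sum>i = 1..2 ^ k. max 1 (2 ^ k * \<bar>h k i\<bar>))"
      unfolding sum_distrib_left by (intro sum_mono) auto
    finally show ?thesis .
  qed (use c in auto)
qed

end

section \<open>The directions of the segments\<close>

text \<open>
  The two children of an angle \<open>b\<close> contribute
  \<open>cos (2 * b + 2 * \<alpha>) + cos (2 * b - 2 * \<alpha>) = 2 * cos (2 * \<alpha>) * cos (2 * b)\<close>, whatever their order.
\<close>

lemma sum_cos_double_dragon_angle: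
  "(\<Sum>i = 1..2 ^ k. cos (2 * dragon_angle \<alpha> k i)) = (2 * cos (2 * \<alpha>)) ^ k"
proof (induction k)
  case (Suc k)
  have pair: "cos (2 * dragon_angle \<alpha> (Suc k) (2 * i - 1)) + cos (2 * dragon_angle \<alpha> (Suc k) (2 * i))
      = 2 * cos (2 * \<alpha>) * cos (2 * dragon_angle \<alpha> k i)" if "1 \<le> i" for i
    unfolding dragon_angle_children[OF that]
    by (simp add: distrib_left right_diff_distrib cos_add cos_diff)
  have double: "(\<Sum>i = 1..2 * m. cos (2 * dragon_angle \<alpha> (Suc k) i))
      = 2 * cos (2 * \<alpha>) * (\<Sum>i = 1..m. cos (2 * dragon_angle \<alpha> k i))" for m
  proof (induction m)
    case (Suc m)
    then show ?case using pair[of "Suc m"] by (simp add: distrib_left del: dragon_angle.simps)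
  qed simp
  show ?case unfolding power_Suc double Suc.IH ..
qed simp

lemma sum_abs_cos_dragon_angle_ge:
  "2 ^ k * ((1 + cos (2 * \<alpha>) ^ k) / 2) \<le> (\<Sum>i = 1..2 ^ k. \<bar>cos (dragon_angle \<alpha> k i)\<bar>)"
proof -
  have "2 ^ k * ((1 + cos (2 * \<alpha>) ^ k) / 2)
      = (\<Sum>i = 1..(2 ^ k :: nat). (1 + cos (2 * dragon_angle \<alpha> k i)) / 2)"
    unfolding sum_divide_distrib[symmetric] sum.distrib sum_cos_double_dragon_angle
    by (simp add: power_mult_distrib algebra_simps)
  also have "\<dots> = (\<Sum>i = 1..2 ^ k. \<bar>cos (dragon_angle \<alpha> k i)\<bar>\<^sup>2)"
    by (simp add: cos_double_cos)
  also have "\<dots> \<le> (\<Sum>i = 1..2 ^ k. \<bar>cos (dragon_angle \<alpha> k i)\<bar>)"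
    unfolding power2_eq_square by (intro sum_mono mult_left_le) auto
  finally show ?thesis .
qed

lemma sum_abs_sin_dragon_angle_ge:
  "2 ^ k * ((1 - cos (2 * \<alpha>) ^ k) / 2) \<le> (\<Sum>i = 1..2 ^ k. \<bar>sin (dragon_angle \<alpha> k i)\<bar>)"
proof -
  have "2 ^ k * ((1 - cos (2 * \<alpha>) ^ k) / 2)
      = (\<Sum>i = 1..(2 ^ k :: nat). (1 - cos (2 * dragon_angle \<alpha> k i)) / 2)"
    unfolding sum_divide_distrib[symmetric] sum_subtractf sum_cos_double_dragon_angle
    by (simp add: power_mult_distrib algebra_simps)
  also have "\<dots> = (\<Sum>i = 1..2 ^ k. \<bar>sin (dragon_angle \<alpha> k i)\<bar>\<^sup>2)"
    by (simp add: cos_double_sin)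
  also have "\<dots> \<le> (\<Sum>i = 1..2 ^ k. \<bar>sin (dragon_angle \<alpha> k i)\<bar>)"
    unfolding power2_eq_square by (intro sum_mono mult_left_le) auto
  finally show ?thesis .
qed

lemma dyadic_increments_dragon_f:
  assumes c: "1 < 2 * cos \<alpha>"
  shows "dyadic_increments (dragon_f \<alpha>) (1 / (2 * cos \<alpha>))"
proof
  show "1 / 2 \<le> 1 / (2 * cos \<alpha>)" "1 / (2 * cos \<alpha>) < 1" using c by (simp_all add: field_simps)
  show "\<bar>dragon_f \<alpha> k i\<bar> \<le> (1 / (2 * cos \<alpha>)) ^ k" for k i
    using c by (auto simp: dragon_f_def power_abs power_divide intro!: divide_right_mono)
  show "dragon_f \<alpha> (Suc k) (2 * i - 1) + dragon_f \<alpha> (Suc k) (2 * i) = dragon_f \<alpha> k i"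
    if "1 \<le> i" for k i
    using c unfolding dragon_f_def dragon_angle_children[OF that]
    by (auto simp: cos_add cos_diff field_simps)
qed

lemma dyadic_increments_dragon_g:
  assumes c: "1 < 2 * cos \<alpha>"
  shows "dyadic_increments (dragon_g \<alpha>) (1 / (2 * cos \<alpha>))"
proof
  show "1 / 2 \<le> 1 / (2 * cos \<alpha>)" "1 / (2 * cos \<alpha>) < 1" using c by (simp_all add: field_simps)
  show "\<bar>dragon_g \<alpha> k i\<bar> \<le> (1 / (2 * cos \<alpha>)) ^ k" for k i
    using c by (auto simp: dragon_g_def power_abs power_divide intro!: divide_right_mono)
  show "dragon_g \<alpha> (Suc k) (2 * i - 1) + dragon_g \<alpha> (Suc k) (2 * i) = dragon_g \<alpha> k i"
    if "1 \<le> i" for k i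
    using c unfolding dragon_g_def dragon_angle_children[OF that]
    by (auto simp: sin_add sin_diff field_simps)
qed

section \<open>The dimension of the coordinate graphs\<close>

theorem theorem2p2:
  fixes \<theta> \<alpha> :: real
  assumes "pi / 3 < \<theta>" and "\<theta> < 5 * pi / 3"
    and "\<alpha> = (pi - \<theta>) / 2"
  shows "has_box_dimension {(t, dragon_x \<theta> t) | t. t \<in> {0..1}} (1 - ln (cos \<alpha>) / ln 2) \<and>
         has_box_dimension {(t, dragon_y \<theta> t) | t. t \<in> {0..1}} (1 - ln (cos \<alpha>) / ln 2)"
proof -
  have c: "1 < 2 * cos \<alpha>" unfolding assms(3) by (rule cos_half_gt[OF assms(1,2)])
  define r where "r = 1 / (2 * cos \<alpha>)"
  interpret X: dyadic_increments "dragon_f \<alpha>" r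
    unfolding r_def by (rule dyadic_increments_dragon_f[OF c])
  interpret Y: dyadic_increments "dragon_g \<alpha>" r
    unfolding r_def by (rule dyadic_increments_dragon_g[OF c])
  have x: "dragon_x \<theta> = X.limit" and y: "dragon_y \<theta> = Y.limit"
    unfolding X.limit_def[abs_def] Y.limit_def[abs_def] dragon_x_def[abs_def] dragon_y_def[abs_def]
      dragon_x_approx_def dragon_y_approx_def assms(3)[symmetric] by auto
  have dim: "ln (4 * r) / ln 2 = 1 - ln (cos \<alpha>) / ln 2"
  proof -
    have "ln (4 * r) = ln 2 - ln (cos \<alpha>)" using c by (simp add: r_def ln_div)
    then show ?thesis by (simp add: diff_divide_distrib)
  qed
  have C: "- 1 / 2 < cos (2 * \<alpha>)"
  proof -
    have "1 / 4 < (cos \<alpha>)\<^sup>2"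
      using power_strict_mono[of "1 / 2" "cos \<alpha>" 2] c by (simp add: power2_eq_square)
    then show ?thesis by (simp add: cos_double_cos)
  qed
  have f: "(\<Sum>i = 1..2 ^ k. \<bar>dragon_f \<alpha> k i\<bar>) = r ^ k * (\<Sum>i = 1..2 ^ k. \<bar>cos (dragon_angle \<alpha> k i)\<bar>)"
    and g: "(\<Sum>i = 1..2 ^ k. \<bar>dragon_g \<alpha> k i\<bar>) = r ^ k * (\<Sum>i = 1..2 ^ k. \<bar>sin (dragon_angle \<alpha> k i)\<bar>)"
    for k
    using c by (simp_all add: dragon_f_def dragon_g_def r_def power_divide power_abs sum_divide_distrib)
  have power_less: "\<bar>cos (2 * \<alpha>) ^ k\<bar> \<le> \<bar>cos (2 * \<alpha>)\<bar>" if "0 < k" for k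
    using power_decreasing[of 1 k "\<bar>cos (2 * \<alpha>)\<bar>"] that by (simp add: power_abs)
  have "has_box_dimension {(t, X.limit t) | t. t \<in> {0..1}} (ln (4 * r) / ln 2)"
  proof (rule X.has_box_dimension_limit_of_average[of "1 / 4"])
    fix k :: nat assume k: "0 < k"
    have "- 1 / 2 \<le> cos (2 * \<alpha>) ^ k"
    proof (cases "0 \<le> cos (2 * \<alpha>)")
      case True
      then show ?thesis using zero_le_power[OF True, of k] by linarith
    next
      case False
      then show ?thesis using power_less[OF k] C by linarith
    qed
    then have "1 / 4 * (2 * r) ^ k \<le> (1 + cos (2 * \<alpha>) ^ k) / 2 * (2 * r) ^ k"
      using X.r_pos by (intro mult_right_mono) auto
    also have "\<dots> = r ^ k * (2 ^ k * ((1 + cos (2 * \<alpha>) ^ k) / 2))"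
      by (simp add: power_mult_distrib)
    also have "\<dots> \<le> (\<Sum>i = 1..2 ^ k. \<bar>dragon_f \<alpha> k i\<bar>)"
      unfolding f using X.r_pos sum_abs_cos_dragon_angle_ge by (intro mult_left_mono) auto
    finally show "1 / 4 * (2 * r) ^ k \<le> (\<Sum>i = 1..2 ^ k. \<bar>dragon_f \<alpha> k i\<bar>)" .
  qed auto
  moreover have "has_box_dimension {(t, Y.limit t) | t. t \<in> {0..1}} (ln (4 * r) / ln 2)"
  proof (cases "cos (2 * \<alpha>) = 1")
    case True
    \<comment> \<open>Then \<open>4 * r = 2\<close>, so one square over each dyadic interval is enough.\<close>
    have "(cos \<alpha>)\<^sup>2 = 1" using True by (simp add: cos_double_cos)
    then have "cos \<alpha> = 1" using c by (auto simp: power2_eq_1_iff)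
    then have r: "4 * r = 2" by (simp add: r_def)
    show ?thesis
    proof (rule Y.has_box_dimension_limit[of 1])
      fix k :: nat
      have "(\<Sum>i = 1..(2 ^ k :: nat). 1) \<le> (\<Sum>i = 1..2 ^ k. max 1 (2 ^ k * \<bar>dragon_g \<alpha> k i\<bar>))"
        by (intro sum_mono) auto
      then show "1 * (4 * r) ^ k \<le> (\<Sum>i = 1..2 ^ k. max 1 (2 ^ k * \<bar>dragon_g \<alpha> k i\<bar>))"
        by (simp add: r)
    qed simp
  next
    case False
    define v where "v = (1 - \<bar>cos (2 * \<alpha>)\<bar>) / 2"
    have "cos (2 * \<alpha>) < 1" using False cos_le_one[of "2 * \<alpha>"] by linarith
    then have v: "0 < v" "v \<le> 1" using C by (auto simp: v_def)
    show ?thesis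
    proof (rule Y.has_box_dimension_limit_of_average[OF v])
      fix k :: nat assume k: "0 < k"
      have "v \<le> (1 - cos (2 * \<alpha>) ^ k) / 2" using power_less[OF k] by (simp add: v_def)
      then have "v * (2 * r) ^ k \<le> (1 - cos (2 * \<alpha>) ^ k) / 2 * (2 * r) ^ k"
        using Y.r_pos by (intro mult_right_mono) auto
      also have "\<dots> = r ^ k * (2 ^ k * ((1 - cos (2 * \<alpha>) ^ k) / 2))"
        by (simp add: power_mult_distrib)
      also have "\<dots> \<le> (\<Sum>i = 1..2 ^ k. \<bar>dragon_g \<alpha> k i\<bar>)"
        unfolding g using Y.r_pos sum_abs_sin_dragon_angle_ge by (intro mult_left_mono) auto
      finally show "v * (2 * r) ^ k \<le> (\<Sum>i = 1..2 ^ k. \<bar>dragon_g \<alpha> k i\<bar>)" .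
    qed
  qed
  ultimately show ?thesis unfolding x y dim by blast
qed

end
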